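(* Let $\mathbb{T}$ be a time scale, let $\alpha,\beta\in\mathbb{T}$ with $\alpha<\beta$, let $\psi,\phi:[\alpha,\beta]_{\mathbb{T}}\to\mathbb{R}$ be Nabla-integrable functions with $\phi>0$, and let $T:[\alpha,\beta]_{\mathbb{T}}\to[0,\infty)$ be Nabla-differentiable and decreasing. If $\psi/\phi$ is increasing (respectively, decreasing) on $[\alpha,\beta]_{\mathbb{T}}$ and $\psi(\alpha)/\phi(\alpha)\ge 1$ (respectively, $\psi(\alpha)/\phi(\alpha)\le 1$), then the function $$s\mapsto \frac{T(s)+\int_{\alpha}^s \psi(\upsilon)\,\nabla\upsilon}{T(s)+\int_{\alpha}^s \phi(\upsilon)\,\nabla\upsilon}$$ is increasing (respectively, decreasing) on the set of $s\in[\alpha,\beta]_{\mathbb{T}}$ at which the denominator is nonzero (that is, on $[\alpha,\beta]_{\mathbb{T}}$ if $T(\alpha)>0$, and on $[\alpha,\beta]_{\mathbb{T}}\setminus\{\alpha\}$ if $T(\alpha)=0$).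
   Context: A time scale $\mathbb{T}$ is a nonempty closed subset of $\mathbb{R}$, and $[\alpha,\beta]_{\mathbb{T}}=[\alpha,\beta]\cap\mathbb{T}$. The backward jump operator is $\rho(t)=\sup\{r\in\mathbb{T}: r<t\}$. A function $f$ is Nabla-differentiable at $t$ with derivative $f^\nabla(t)$ if for every $\varepsilon>0$ there is a neighbourhood $U$ of $t$ with $|f(\rho(t))-f(r)-f^\nabla(t)(\rho(t)-r)|\le\varepsilon|\rho(t)-r|$ for all $r\in U\cap\mathbb{T}$ (not required at the left endpoint $\alpha$ if $\alpha$ is right-scattered). The Nabla integral $\int_a^b f(\upsilon)\,\nabla\upsilon$ ($a\le b$ in $\mathbb{T}$) is the standard one, i.e. the integral of $f$ over $(a,b]\cap\mathbb{T}$ with respect to the Nabla measure $\mu_\nabla$ on $\mathbb{T}$, determined by $\mu_\nabla((c,d]\cap\mathbb{T})=d-c$ for $c\le d$ in $\mathbb{T}$. "Increasing" and "decreasing" are meant in the non-strict sense. *)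

theory Defs
  imports "HOL-Analysis.Analysis"
begin

definition time_scale :: "real set \<Rightarrow> bool" where
  "time_scale S \<longleftrightarrow> closed S \<and> S \<noteq> {}"

definition ts_interval :: "real set \<Rightarrow> real \<Rightarrow> real \<Rightarrow> real set" where
  "ts_interval S a b = {a..b} \<inter> S"

(* The jump operators follow the conventions "sup {} = inf S" and "inf {} = sup S", so that
   a minimum (maximum) of S is its own backward (forward) jump. *)
definition backward_jump :: "real set \<Rightarrow> real \<Rightarrow> real" where
  "backward_jump S t = (if \<exists>r\<in>S. r < t then Sup {r \<in> S. r < t} else Inf S)"

definition forward_jump :: "real set \<Rightarrow> real \<Rightarrow> real" where
  "forward_jump S t = (if \<exists>r\<in>S. t < r then Inf {r \<in> S. t < r} else Sup S)"

definition has_nabla_derivative :: "real set \<Rightarrow> (real \<Rightarrow> real) \<Rightarrow> real \<Rightarrow> real \<Rightarrow> bool" where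
  "has_nabla_derivative S f D t \<longleftrightarrow>
     (\<forall>\<epsilon>>0. \<exists>U. open U \<and> t \<in> U \<and>
        (\<forall>r \<in> U \<inter> S. \<bar>f (backward_jump S t) - f r - D * (backward_jump S t - r)\<bar>
                       \<le> \<epsilon> * \<bar>backward_jump S t - r\<bar>))"

(* S without its minimum if S has a minimum and that minimum is right-scattered. *)
definition nabla_kappa :: "real set \<Rightarrow> real set" where
  "nabla_kappa S = {t \<in> S. \<not> ((\<forall>r\<in>S. t \<le> r) \<and> t < forward_jump S t)}"

(* For a function given only on a time scale interval, S is that interval (itself a time
   scale), so that no value of f outside S is ever used. *)
definition nabla_differentiable_on :: "real set \<Rightarrow> (real \<Rightarrow> real) \<Rightarrow> bool" where
  "nabla_differentiable_on S f \<longleftrightarrow> (\<forall>t \<in> nabla_kappa S. \<exists>D. has_nabla_derivative S f D t)"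

(* The nabla measure is the (completed) Lebesgue-Stieltjes measure of the function sending x
   to the last point of S not exceeding x (constantly inf S to the left of S). It gives
   measure d - c to {c<..d} \<inter> S for c \<le> d in S, see emeasure_nabla_measure below. *)
definition last_point :: "real set \<Rightarrow> real \<Rightarrow> real" where
  "last_point S x = (if \<exists>r\<in>S. r \<le> x then Sup {r \<in> S. r \<le> x} else Inf S)"

definition nabla_measure :: "real set \<Rightarrow> real measure" where
  "nabla_measure S = restrict_space (completion (interval_measure (last_point S))) S"

definition nabla_integrable :: "real set \<Rightarrow> (real \<Rightarrow> real) \<Rightarrow> real \<Rightarrow> real \<Rightarrow> bool" where
  "nabla_integrable S f a b \<longleftrightarrow> set_integrable (nabla_measure S) ({a<..b} \<inter> S) f"

definition nabla_integral :: "real set \<Rightarrow> real \<Rightarrow> real \<Rightarrow> (real \<Rightarrow> real) \<Rightarrow> real" where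
  "nabla_integral S a b f = set_lebesgue_integral (nabla_measure S) ({a<..b} \<inter> S) f"


lemma last_point_props:
  assumes S: "time_scale S" and r: "r \<in> S" "r \<le> x"
  shows "last_point S x \<in> S" "last_point S x \<le> x" "r \<le> last_point S x"
proof -
  let ?A = "{r \<in> S. r \<le> x}"
  have ne: "?A \<noteq> {}" and bdd: "bdd_above ?A" using r by (auto intro!: bdd_aboveI)
  have "?A = S \<inter> {..x}" by auto
  hence "closed ?A" using S by (simp add: time_scale_def closed_Int)
  hence "Sup ?A \<in> ?A" by (rule closed_contains_Sup[OF ne bdd])
  moreover have "last_point S x = Sup ?A" using r by (auto simp: last_point_def)
  moreover have "r \<le> Sup ?A" by (rule cSup_upper) (use r bdd in auto)
  ultimately show "last_point S x \<in> S" "last_point S x \<le> x" "r \<le> last_point S x" by auto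
qed

lemma last_point_eq:
  assumes "x \<in> S" "time_scale S"
  shows "last_point S x = x"
  using last_point_props[OF assms(2) assms(1) order_refl] by auto

lemma last_point_mono:
  assumes S: "time_scale S" and "x \<le> y"
  shows "last_point S x \<le> last_point S y"
proof (cases "\<exists>r\<in>S. r \<le> x")
  case True
  then obtain r where r: "r \<in> S" "r \<le> x" by blast
  note p = last_point_props[OF S r]
  show ?thesis using last_point_props(3)[OF S p(1)] p(2) assms(2) by auto
next
  case False
  hence b: "bdd_below S" by (auto intro!: bdd_belowI[of _ x])
  from False have "last_point S x = Inf S" by (simp add: last_point_def)
  moreover have "Inf S \<le> last_point S y"
  proof (cases "\<exists>r\<in>S. r \<le> y")
    case True
    then obtain r where r: "r \<in> S" "r \<le> y" by blast
    show ?thesis using last_point_props(1)[OF S r] b by (rule cInf_lower)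
  qed (auto simp: last_point_def)
  ultimately show ?thesis by simp
qed

lemma last_point_const:
  assumes S: "time_scale S" and xy: "x \<le> y" and gap: "{x<..y} \<inter> S = {}"
  shows "last_point S y = last_point S x"
proof -
  have "{r \<in> S. r \<le> y} = {r \<in> S. r \<le> x}"
    using xy gap by force
  moreover from this have "(\<exists>r\<in>S. r \<le> y) = (\<exists>r\<in>S. r \<le> x)" by blast
  ultimately show ?thesis by (simp add: last_point_def)
qed

lemma last_point_right_cont:
  assumes S: "time_scale S"
  shows "continuous (at_right x) (last_point S)"
proof -
  have cont: "\<exists>d>0. \<forall>y. x < y \<and> y < x + d \<longrightarrow> \<bar>last_point S y - last_point S x\<bar> < e" if "e > 0" for e
  proof (cases "x \<in> S")
    case True
    show ?thesis
    proof (intro exI[of _ e] conjI allI impI)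
      fix y assume y: "x < y \<and> y < x + e"
      with last_point_props[OF S True, of y] last_point_eq[OF True S]
      show "\<bar>last_point S y - last_point S x\<bar> < e" by auto
    qed fact
  next
    case False
    have "open (- S)" using S by (simp add: time_scale_def open_Compl)
    with False obtain d where d: "d > 0" "ball x d \<subseteq> - S"
      by (auto simp: open_contains_ball)
    show ?thesis
    proof (intro exI[of _ d] conjI allI impI)
      fix y assume y: "x < y \<and> y < x + d"
      have "{x<..y} \<subseteq> ball x d" using y by (auto simp: dist_real_def)
      hence "{x<..y} \<inter> S = {}" using d by auto
      thus "\<bar>last_point S y - last_point S x\<bar> < e"
        using last_point_const[OF S, of x y] y \<open>e > 0\<close> by simp
    qed fact
  qed
  show ?thesis
    unfolding continuous_within Lim_within dist_real_def
  proof (intro allI impI)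
    fix e :: real assume "e > 0"
    with cont obtain d where d: "d > 0"
      and le: "\<And>y. x < y \<Longrightarrow> y < x + d \<Longrightarrow> \<bar>last_point S y - last_point S x\<bar> < e" by blast
    show "\<exists>d>0. \<forall>y\<in>{x<..}. 0 < \<bar>y - x\<bar> \<and> \<bar>y - x\<bar> < d \<longrightarrow> \<bar>last_point S y - last_point S x\<bar> < e"
      by (intro exI[of _ d] conjI ballI impI d le) auto
  qed
qed

lemma emeasure_interval_last_point:
  assumes S: "time_scale S" and "a \<le> b"
  shows "emeasure (interval_measure (last_point S)) {a<..b} = last_point S b - last_point S a"
  using assms by (intro emeasure_interval_measure_Ioc last_point_mono last_point_right_cont) auto

lemma null_sets_compl_time_scale:
  assumes S: "time_scale S"
  shows "- S \<in> null_sets (interval_measure (last_point S))"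
proof -
  let ?M = "interval_measure (last_point S)"
  let ?I = "{(p, q). p \<in> \<rat> \<and> q \<in> \<rat> \<and> p \<le> q \<and> {p<..q} \<inter> S = {}}"
  have "?I \<subseteq> \<rat> \<times> \<rat>" by auto
  hence cnt: "countable ?I" by (rule countable_subset) (intro countable_SIGMA countable_rat)
  have "(\<Union>(p, q)\<in>?I. {p<..q}) \<in> null_sets ?M"
  proof (rule null_sets_UN'[OF cnt])
    fix i assume "i \<in> ?I"
    then obtain p q where "i = (p, q)" "p \<le> q" "{p<..q} \<inter> S = {}" by auto
    thus "(case i of (p, q) \<Rightarrow> {p<..q}) \<in> null_sets ?M"
      using emeasure_interval_last_point[OF S, of p q] last_point_const[OF S, of p q]
      by (auto simp: null_sets_def)
  qed
  moreover have "- S \<subseteq> (\<Union>(p, q)\<in>?I. {p<..q})"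
  proof
    fix x assume x: "x \<in> - S"
    have "open (- S)" using S by (simp add: time_scale_def open_Compl)
    with x obtain d where d: "d > 0" "ball x d \<subseteq> - S" by (auto simp: open_contains_ball)
    obtain p where p: "p \<in> \<rat>" "x - d < p" "p < x"
      using Rats_dense_in_real[of "x - d" x] d by auto
    obtain q where q: "q \<in> \<rat>" "x < q" "q < x + d"
      using Rats_dense_in_real[of x "x + d"] d by auto
    have "{p<..q} \<subseteq> ball x d" using p q by (auto simp: dist_real_def)
    hence "(p, q) \<in> ?I" using p q d by auto
    moreover have "x \<in> {p<..q}" using p q by auto
    ultimately show "x \<in> (\<Union>(p, q)\<in>?I. {p<..q})" by blast
  qed
  moreover have "- S \<in> sets ?M" using S by (simp add: time_scale_def borel_closed)
  ultimately show ?thesis by (blast intro: null_sets_subset)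
qed

lemma emeasure_nabla_measure:
  assumes S: "time_scale S" and cd: "c \<in> S" "d \<in> S" "c \<le> d"
  shows "emeasure (nabla_measure S) ({c<..d} \<inter> S) = ennreal (d - c)"
proof -
  let ?M = "interval_measure (last_point S)"
  have Sb: "S \<in> sets borel" using S by (simp add: time_scale_def borel_closed)
  have "emeasure (nabla_measure S) ({c<..d} \<inter> S) = emeasure (completion ?M) ({c<..d} \<inter> S)"
    unfolding nabla_measure_def by (rule emeasure_restrict_space) (use Sb in auto)
  also have "\<dots> = emeasure ?M ({c<..d} - (- S))"
    by (subst emeasure_completion) (use Sb in \<open>auto simp: Diff_eq\<close>)
  also have "\<dots> = emeasure ?M {c<..d}"
    by (rule emeasure_Diff_null_set[OF null_sets_compl_time_scale[OF S]]) simp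
  also have "\<dots> = ennreal (d - c)"
    using emeasure_interval_last_point[OF S cd(3)] last_point_eq[OF cd(1) S]
      last_point_eq[OF cd(2) S] by simp
  finally show ?thesis .
qed

end

theory Submission
  imports Defs
begin

text \<open>
  For \<open>s \<le> t\<close> let \<open>k = \<psi> s / \<phi> s\<close>. Monotonicity of \<open>\<psi> / \<phi>\<close> makes the integral of \<open>\<psi>\<close> at most
  \<open>k\<close> times that of \<open>\<phi>\<close> from \<open>\<alpha>\<close> to \<open>s\<close>, and at least \<open>k\<close> times that of \<open>\<phi>\<close> from \<open>s\<close> to \<open>t\<close>.
  Moreover \<open>k \<ge> 1\<close>, and the inequality between the two quotients is then algebra, where \<open>T\<close>
  enters only through \<open>T s \<ge> T t \<ge> 0\<close>. The decreasing case is the increasing case for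
  \<open>2\<phi> - \<psi>\<close>, which turns the quotient \<open>N / D\<close> into \<open>2 - N / D\<close>.
\<close>

text \<open>In the application, \<open>a\<close> and \<open>b\<close> are the values of
  \<open>T\<close> at points \<open>s \<le> t\<close>, \<open>P\<close> and \<open>Q\<close> are the
  integrals of \<open>\<psi>\<close> and \<open>\<phi>\<close> up to \<open>s\<close>, and
  \<open>p\<close> and \<open>q\<close> those from \<open>s\<close> to \<open>t\<close>. The
  cross-multiplied difference is a sum of two nonnegative terms: one comes from
  \<open>b \<le> a\<close> and \<open>Q \<le> P\<close>, the other from comparing the left quotient
  and the increments with \<open>k\<close>.\<close>

lemma shifted_ratio_le:
  fixes a b P Q p q k :: real
  assumes "0 \<le> b" "b \<le> a" "0 \<le> Q" "0 \<le> q" "1 \<le> k"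
    and "Q \<le> P" "P \<le> k * Q" "k * q \<le> p"
    and "0 < a + Q" "0 < b + (Q + q)"
  shows "(a + P) / (a + Q) \<le> (b + (P + p)) / (b + (Q + q))"
proof -
  \<comment> \<open>As \<open>1 \<le> k\<close> and \<open>0 \<le> a\<close>, adding
    \<open>a\<close> to both \<open>P\<close> and \<open>Q\<close> preserves the bound
    \<open>P \<le> k * Q\<close>.\<close>
  have "a + P \<le> k * (a + Q)"
    using assms mult_right_mono[of 1 k a] by (simp add: distrib_left)
  hence "q * (a + P) \<le> q * (k * (a + Q))"
    using \<open>0 \<le> q\<close> by (rule mult_left_mono)
  also have "\<dots> = (k * q) * (a + Q)" by simp
  also have "\<dots> \<le> p * (a + Q)"
    using assms by (intro mult_right_mono) auto
  finally have 1: "q * (a + P) \<le> p * (a + Q)" .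
  have 2: "0 \<le> (a - b) * (P - Q)" using assms by simp
  \<comment> \<open>The first product isolates the drop from \<open>a\<close> to \<open>b\<close>;
    the bracket is what would remain if \<open>a = b\<close>.\<close>
  have "(b + (P + p)) * (a + Q) - (a + P) * (b + (Q + q))
      = (a - b) * (P - Q) + (p * (a + Q) - q * (a + P))"
    by (simp add: algebra_simps)
  with 1 2 have "(a + P) * (b + (Q + q)) \<le> (b + (P + p)) * (a + Q)" by linarith
  thus ?thesis using assms(9,10) by (simp add: pos_divide_le_eq pos_le_divide_eq)
qed

lemma sets_nabla_measure_Ioc:
  assumes "time_scale S"
  shows "{a<..b} \<inter> S \<in> sets (nabla_measure S)"
proof -
  have "S \<in> sets borel" using assms by (simp add: time_scale_def borel_closed)
  thus ?thesis
    unfolding nabla_measure_def by (subst sets_restrict_space_iff) auto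
qed

lemma nabla_integrable_subinterval:
  assumes "time_scale S" "nabla_integrable S f a b" "a \<le> c" "d \<le> b"
  shows "nabla_integrable S f c d"
  using assms sets_nabla_measure_Ioc[OF assms(1)]
  unfolding nabla_integrable_def by (elim set_integrable_subset) auto

text \<open>The half-open pieces are disjoint, so a possible atom of the nabla measure at
  \<open>c\<close> is counted exactly once.\<close>

lemma nabla_integral_combine:
  assumes S: "time_scale S" and f: "nabla_integrable S f a b" and c: "a \<le> c" "c \<le> b"
  shows "nabla_integral S a b f = nabla_integral S a c f + nabla_integral S c b f"
proof -
  have "{a<..b} \<inter> S = ({a<..c} \<inter> S) \<union> ({c<..b} \<inter> S)" using c by auto
  moreover have "nabla_integrable S f a c" "nabla_integrable S f c b"
    using nabla_integrable_subinterval[OF S f] c by auto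
  ultimately show ?thesis
    unfolding nabla_integral_def nabla_integrable_def by (subst set_integral_Un[symmetric]) auto
qed

lemma nabla_integral_mono:
  assumes "nabla_integrable S f a b" "nabla_integrable S g a b"
    and "\<And>x. x \<in> S \<Longrightarrow> a < x \<Longrightarrow> x \<le> b \<Longrightarrow> f x \<le> g x"
  shows "nabla_integral S a b f \<le> nabla_integral S a b g"
  using assms unfolding nabla_integrable_def nabla_integral_def by (intro set_integral_mono) auto

lemma nabla_integrable_cmult:
  "nabla_integrable S f a b \<Longrightarrow> nabla_integrable S (\<lambda>x. k * f x) a b"
  unfolding nabla_integrable_def by simp

lemma nabla_integral_cmult: "nabla_integral S a b (\<lambda>x. k * f x) = k * nabla_integral S a b f"
  unfolding nabla_integral_def by simp

lemma nabla_integrable_diff: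
  "\<lbrakk>nabla_integrable S f a b; nabla_integrable S g a b\<rbrakk>
    \<Longrightarrow> nabla_integrable S (\<lambda>x. f x - g x) a b"
  unfolding nabla_integrable_def by (rule set_integral_diff)

lemma nabla_integral_diff:
  "\<lbrakk>nabla_integrable S f a b; nabla_integrable S g a b\<rbrakk>
    \<Longrightarrow> nabla_integral S a b (\<lambda>x. f x - g x) = nabla_integral S a b f - nabla_integral S a b g"
  unfolding nabla_integrable_def nabla_integral_def by (rule set_integral_diff)

text \<open>The domain \<open>{a<..a}\<close> is empty, so even an atom at \<open>a\<close>
  contributes nothing.\<close>

lemma nabla_integral_self: "nabla_integral S a a f = 0"
  by (simp add: nabla_integral_def set_lebesgue_integral_def)

lemma nabla_integral_nonneg:
  assumes "\<And>x. x \<in> S \<Longrightarrow> a < x \<Longrightarrow> x \<le> b \<Longrightarrow> 0 \<le> f x"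
  shows "0 \<le> nabla_integral S a b f"
  unfolding nabla_integral_def set_lebesgue_integral_def
  using assms by (intro integral_nonneg_AE AE_I2) (auto simp: indicator_def)

text \<open>If the integral vanished, the nonnegative integrand would be zero almost everywhere. As
  \<open>f\<close> is positive on the domain, the domain would then be a null set, whereas its nabla
  measure is \<open>b - a\<close>.\<close>

lemma nabla_integral_pos:
  assumes S: "time_scale S" and ab: "a \<in> S" "b \<in> S" "a < b"
    and f: "nabla_integrable S f a b"
    and pos: "\<And>x. x \<in> S \<Longrightarrow> a < x \<Longrightarrow> x \<le> b \<Longrightarrow> 0 < f x"
  shows "0 < nabla_integral S a b f"
proof -
  let ?M = "nabla_measure S" and ?A = "{a<..b} \<inter> S"
  let ?g = "\<lambda>x. indicator ?A x *\<^sub>R f x"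
  have g0: "AE x in ?M. 0 \<le> ?g x"
    using pos by (intro AE_I2) (auto simp: indicator_def less_imp_le)
  have int: "integrable ?M ?g" using f by (simp add: nabla_integrable_def set_integrable_def)
  have "integral\<^sup>L ?M ?g \<noteq> 0"
  proof
    assume "integral\<^sup>L ?M ?g = 0"
    hence "AE x in ?M. ?g x = 0"
      using integral_nonneg_eq_0_iff_AE[OF int g0] by simp
    hence "AE x in ?M. x \<notin> ?A"
      by eventually_elim (use pos in \<open>fastforce simp: indicator_def split: if_splits\<close>)
    \<comment> \<open>The exceptional set of the preceding statement is \<open>?A\<close> itself,
      which is measurable and lies in the space.\<close>
    hence "emeasure ?M ?A = 0"
      using AE_iff_measurable[OF sets_nabla_measure_Ioc[OF S, of a b], of "\<lambda>x. x \<notin> ?A"]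
        sets.sets_into_space[OF sets_nabla_measure_Ioc[OF S, of a b]] by blast
    thus False using emeasure_nabla_measure[OF S, of a b] ab by simp
  qed
  moreover have "0 \<le> integral\<^sup>L ?M ?g" using g0 by (rule integral_nonneg_AE)
  ultimately show ?thesis by (simp add: nabla_integral_def set_lebesgue_integral_def)
qed

text \<open>The increasing case is kept general in \<open>\<psi>\<close>, because the decreasing
  case applies it with \<open>2 * \<phi> t - \<psi> t\<close> in place of
  \<open>\<psi> t\<close>.\<close>

lemma nabla_ratio_mono:
  fixes \<psi> \<phi> T :: "real \<Rightarrow> real"
  assumes S: "time_scale S" and ab: "\<alpha> \<in> S"
    and \<psi>: "nabla_integrable S \<psi> \<alpha> \<beta>" and \<phi>: "nabla_integrable S \<phi> \<alpha> \<beta>"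
    and pos: "\<forall>t \<in> ts_interval S \<alpha> \<beta>. \<phi> t > 0"
    and T0: "\<forall>t \<in> ts_interval S \<alpha> \<beta>. T t \<ge> 0"
    and T: "antimono_on (ts_interval S \<alpha> \<beta>) T"
    and mono: "mono_on (ts_interval S \<alpha> \<beta>) (\<lambda>t. \<psi> t / \<phi> t)" and start: "\<psi> \<alpha> / \<phi> \<alpha> \<ge> 1"
  shows "mono_on {s \<in> ts_interval S \<alpha> \<beta>. T s + nabla_integral S \<alpha> s \<phi> \<noteq> 0}
    (\<lambda>s. (T s + nabla_integral S \<alpha> s \<psi>) / (T s + nabla_integral S \<alpha> s \<phi>))"
proof (rule mono_onI, clarify)
  fix s t assume s: "s \<in> ts_interval S \<alpha> \<beta>" and t: "t \<in> ts_interval S \<alpha> \<beta>" and st: "s \<le> t"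
    and D: "T s + nabla_integral S \<alpha> s \<phi> \<noteq> 0" "T t + nabla_integral S \<alpha> t \<phi> \<noteq> 0"
  define k where "k = \<psi> s / \<phi> s"
  have I: "x \<in> ts_interval S \<alpha> \<beta>" if "x \<in> S" "\<alpha> \<le> x" "x \<le> \<beta>" for x
    using that by (simp add: ts_interval_def)
  have s': "\<alpha> \<le> s" "s \<le> \<beta>" and t': "t \<le> \<beta>" using s t by (auto simp: ts_interval_def)
  have ratio: "\<psi> x / \<phi> x \<le> \<psi> y / \<phi> y"
    if "x \<in> ts_interval S \<alpha> \<beta>" "y \<in> ts_interval S \<alpha> \<beta>" "x \<le> y" for x y
    using mono_onD[OF mono] that by auto
  have \<alpha>: "\<alpha> \<in> ts_interval S \<alpha> \<beta>" using s' ab by (intro I) auto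
  \<comment> \<open>The quotient is at least 1 at \<alpha> and can only grow. This gives both
    \<open>1 \<le> k\<close> and the comparison of the two integrals up to \<open>s\<close>.\<close>
  have one: "\<phi> x \<le> \<psi> x" if "x \<in> ts_interval S \<alpha> \<beta>" for x
  proof -
    have "1 \<le> \<psi> x / \<phi> x"
      using start ratio[OF \<alpha> that] that by (simp add: ts_interval_def)
    thus ?thesis using pos that by (simp add: le_divide_eq_1_pos)
  qed
  have k1: "1 \<le> k" using one[OF s] pos s by (auto simp: k_def)
  have int: "nabla_integrable S f c d"
    if "nabla_integrable S f \<alpha> \<beta>" "\<alpha> \<le> c" "d \<le> \<beta>" for f c d
    using nabla_integrable_subinterval[OF S] that by blast
  note ints = int[OF \<psi>] int[OF \<phi>]
  have below: "\<psi> x \<le> k * \<phi> x" if "x \<in> ts_interval S \<alpha> \<beta>" "x \<le> s" for x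
    using ratio[OF that(1) s that(2)] pos that by (simp add: k_def[symmetric] pos_divide_le_eq)
  have above: "k * \<phi> x \<le> \<psi> x" if "x \<in> ts_interval S \<alpha> \<beta>" "s \<le> x" for x
    using ratio[OF s that] pos that by (simp add: k_def[symmetric] pos_le_divide_eq)
  have P: "nabla_integral S \<alpha> s \<psi> \<le> k * nabla_integral S \<alpha> s \<phi>"
    unfolding nabla_integral_cmult[symmetric]
    using s' by (intro nabla_integral_mono nabla_integrable_cmult ints below I) auto
  have p: "k * nabla_integral S s t \<phi> \<le> nabla_integral S s t \<psi>"
    unfolding nabla_integral_cmult[symmetric]
    using s' t' by (intro nabla_integral_mono nabla_integrable_cmult ints above I) auto
  have QP: "nabla_integral S \<alpha> s \<phi> \<le> nabla_integral S \<alpha> s \<psi>"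
    using s' by (intro nabla_integral_mono ints one I) auto
  have nonneg: "0 \<le> nabla_integral S c d \<phi>" if "\<alpha> \<le> c" "d \<le> \<beta>" for c d
    using pos that by (intro nabla_integral_nonneg) (auto intro!: less_imp_le simp: ts_interval_def)
  have split: "nabla_integral S \<alpha> t f = nabla_integral S \<alpha> s f + nabla_integral S s t f"
    if "nabla_integrable S f \<alpha> \<beta>" for f
    using int[OF that] s' st t' by (intro nabla_integral_combine[OF S]) auto
  have "0 \<le> T s" "0 \<le> T t" "T t \<le> T s"
    using T0 s t monotone_onD[OF T s t st] by auto
  \<comment> \<open>Both denominators are sums of nonnegative terms, so being nonzero makes them
    positive.\<close>
  moreover have "0 < T s + nabla_integral S \<alpha> s \<phi>"
    "0 < T t + (nabla_integral S \<alpha> s \<phi> + nabla_integral S s t \<phi>)"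
    using D calculation nonneg[of \<alpha> s] nonneg[of \<alpha> t] s' t' by (auto simp: split[OF \<phi>])
  ultimately show "(T s + nabla_integral S \<alpha> s \<psi>) / (T s + nabla_integral S \<alpha> s \<phi>)
      \<le> (T t + nabla_integral S \<alpha> t \<psi>) / (T t + nabla_integral S \<alpha> t \<phi>)"
    unfolding split[OF \<phi>] split[OF \<psi>]
    using k1 P p QP nonneg s' t' by (intro shifted_ratio_le) auto
qed

theorem theorem2p5:
  fixes \<T> :: "real set" and \<alpha> \<beta> :: real and \<psi> \<phi> T :: "real \<Rightarrow> real"
  assumes "time_scale \<T>"
    and "\<alpha> \<in> \<T>" and "\<beta> \<in> \<T>" and "\<alpha> < \<beta>"
    and "nabla_integrable \<T> \<psi> \<alpha> \<beta>" and "nabla_integrable \<T> \<phi> \<alpha> \<beta>"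
    and "\<forall>t \<in> ts_interval \<T> \<alpha> \<beta>. \<phi> t > 0"
    and "\<forall>t \<in> ts_interval \<T> \<alpha> \<beta>. T t \<ge> 0"
    and "nabla_differentiable_on (ts_interval \<T> \<alpha> \<beta>) T"
    and "antimono_on (ts_interval \<T> \<alpha> \<beta>) T"
  shows "let N = (\<lambda>s. T s + nabla_integral \<T> \<alpha> s \<psi>);
             D = (\<lambda>s. T s + nabla_integral \<T> \<alpha> s \<phi>);
             A = {s \<in> ts_interval \<T> \<alpha> \<beta>. D s \<noteq> 0}
         in (mono_on (ts_interval \<T> \<alpha> \<beta>) (\<lambda>t. \<psi> t / \<phi> t) \<and> \<psi> \<alpha> / \<phi> \<alpha> \<ge> 1
               \<longrightarrow> mono_on A (\<lambda>s. N s / D s))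
          \<and> (antimono_on (ts_interval \<T> \<alpha> \<beta>) (\<lambda>t. \<psi> t / \<phi> t) \<and> \<psi> \<alpha> / \<phi> \<alpha> \<le> 1
               \<longrightarrow> antimono_on A (\<lambda>s. N s / D s))
          \<and> (T \<alpha> > 0 \<longrightarrow> A = ts_interval \<T> \<alpha> \<beta>)
          \<and> (T \<alpha> = 0 \<longrightarrow> A = ts_interval \<T> \<alpha> \<beta> - {\<alpha>})"
proof -
  note S = assms(1) and \<psi> = assms(5) and \<phi> = assms(6) and pos = assms(7) and T0 = assms(8)
    and T = assms(10)
  define I where "I = ts_interval \<T> \<alpha> \<beta>"
  define N where "N = (\<lambda>s. T s + nabla_integral \<T> \<alpha> s \<psi>)"
  define D where "D = (\<lambda>s. T s + nabla_integral \<T> \<alpha> s \<phi>)"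
  define A where "A = {s \<in> I. D s \<noteq> 0}"
  have \<alpha>I: "\<alpha> \<in> I" using assms(2,4) by (simp add: I_def ts_interval_def)
  have inc: "mono_on A (\<lambda>s. N s / D s)"
    if "mono_on I (\<lambda>t. \<psi> t / \<phi> t)" "\<psi> \<alpha> / \<phi> \<alpha> \<ge> 1"
    using nabla_ratio_mono[OF S assms(2) \<psi> \<phi> pos T0 T] that
    by (simp add: A_def N_def D_def I_def)
  have dec: "antimono_on A (\<lambda>s. N s / D s)"
    if mono: "antimono_on I (\<lambda>t. \<psi> t / \<phi> t)" and start: "\<psi> \<alpha> / \<phi> \<alpha> \<le> 1"
  proof -
    \<comment> \<open>The map sending \<open>r\<close> to \<open>2 - r\<close> reverses the order
      and fixes 1, so it carries both the monotonicity and the bound at \<alpha> to those of the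
      increasing case.\<close>
    let ?\<chi> = "\<lambda>t. 2 * \<phi> t - \<psi> t"
    have ratio: "?\<chi> t / \<phi> t = 2 - \<psi> t / \<phi> t" if "t \<in> I" for t
      using pos that by (auto simp: I_def diff_divide_distrib)
    have "mono_on I (\<lambda>t. ?\<chi> t / \<phi> t)"
      using monotone_onD[OF mono] by (intro mono_onI) (simp add: ratio)
    moreover have "?\<chi> \<alpha> / \<phi> \<alpha> \<ge> 1" using start by (simp add: ratio[OF \<alpha>I])
    ultimately have m: "mono_on A (\<lambda>s. (T s + nabla_integral \<T> \<alpha> s ?\<chi>) / D s)"
      using nabla_ratio_mono[OF S assms(2) nabla_integrable_diff[OF nabla_integrable_cmult[OF \<phi>] \<psi>]
          \<phi> pos T0 T]
      by (simp add: A_def D_def I_def)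
    have eq: "(T s + nabla_integral \<T> \<alpha> s ?\<chi>) / D s = 2 - N s / D s" if "s \<in> A" for s
    proof -
      have "s \<le> \<beta>" "D s \<noteq> 0" using that by (auto simp: A_def I_def ts_interval_def)
      hence "nabla_integral \<T> \<alpha> s ?\<chi> = 2 * nabla_integral \<T> \<alpha> s \<phi> - nabla_integral \<T> \<alpha> s \<psi>"
        using nabla_integrable_subinterval[OF S] \<psi> \<phi>
        by (subst nabla_integral_diff) (auto intro: nabla_integrable_cmult simp: nabla_integral_cmult)
      \<comment> \<open>The same \<open>T\<close> serves as shift for the new function because
        \<open>T s = 2 * T s - T s\<close>.\<close>
      hence "T s + nabla_integral \<T> \<alpha> s ?\<chi> = 2 * D s - N s" by (simp add: D_def N_def)
      thus ?thesis using \<open>D s \<noteq> 0\<close> by (simp add: diff_divide_distrib)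
    qed
    show ?thesis
    proof (rule monotone_onI)
      fix s t assume "s \<in> A" "t \<in> A" "s \<le> t"
      with mono_onD[OF m this] show "N t / D t \<le> N s / D s" by (simp add: eq)
    qed
  qed
  \<comment> \<open>The only possible zero of \<open>D\<close> is \<alpha>: to the right of it the
    integral of \<open>\<phi>\<close> is already positive.\<close>
  have D\<alpha>: "D \<alpha> = T \<alpha>" by (simp add: D_def nabla_integral_self)
  have "D s > 0" if s: "s \<in> I" "s \<noteq> \<alpha>" for s
  proof -
    have s': "\<alpha> < s" "s \<le> \<beta>" "s \<in> \<T>" using s by (auto simp: I_def ts_interval_def)
    have "0 < nabla_integral \<T> \<alpha> s \<phi>"
      using s' pos nabla_integrable_subinterval[OF S \<phi>] assms(2)
      by (intro nabla_integral_pos[OF S]) (auto simp: ts_interval_def)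
    moreover have "T s \<ge> 0" using T0 s by (auto simp: I_def)
    ultimately show ?thesis by (simp add: D_def)
  qed
  hence "T \<alpha> > 0 \<longrightarrow> A = I" "T \<alpha> = 0 \<longrightarrow> A = I - {\<alpha>}"
    using D\<alpha> by (auto simp: A_def) (metis less_irrefl)+
  with inc dec show ?thesis
    unfolding Let_def A_def N_def D_def I_def by blast
qed

end
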